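(* Let $d\ge2$ be an integer and let $\mu,\nu\in\mathbb{R}$. The linear map $\Lambda_{\mu,\nu}:M_d\to M_d$, $\Lambda_{\mu,\nu}=(1-\mu-\nu)\,T+\mu\,\tau_0+\nu\,\Delta$, is: 1. positive if and only if $$0\le\mu\le\frac{d}{d-1}\quad\text{and}\quad -\frac{2}{d}\,\mu\le\nu\le\frac{d}{d-1}-\mu;$$ 2. for each $k\in\{2,\ldots,d\}$, $k$-positive if and only if $$0\le\mu\le\frac{d}{d-1}\quad\text{and}\quad 1-\frac{d+1}{d}\,\mu\le\nu\le 1-\frac{d-1}{d}\,\mu.$$
   Context: $M_d$ is the algebra of $d\times d$ complex matrices. $T$ is the transposition on $M_d$ in the standard basis, $\tau_0(X)=\frac{1}{d}(\operatorname{Tr}X)\,\mathbb{I}_d$ with $\mathbb{I}_d$ the identity matrix, and $\Delta(X)$ is the diagonal part of $X$ (the diagonal matrix with the same diagonal entries as $X$ in the standard basis). A linear map is positive if it sends positive semidefinite matrices to positive semidefinite matrices; it is $k$-positive if $\mathrm{id}_{M_k}\otimes\Lambda$ is positive. *)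

theory Defs
  imports "Jordan_Normal_Form.Schur_Decomposition"
begin

text \<open>\<open>M\<^sub>d\<close> is \<^term>\<open>carrier_mat d d\<close> over the complex numbers. A linear map on \<open>M\<^sub>d\<close> is a function
  on matrices of which only the values on this carrier matter; rows and columns are numbered
  from 0.\<close>

definition linear_on_mat :: "nat \<Rightarrow> (complex mat \<Rightarrow> complex mat) \<Rightarrow> bool" where
  "linear_on_mat d \<Phi> \<longleftrightarrow>
     (\<forall>X\<in>carrier_mat d d. \<Phi> X \<in> carrier_mat d d) \<and>
     (\<forall>X\<in>carrier_mat d d. \<forall>Y\<in>carrier_mat d d. \<Phi> (X + Y) = \<Phi> X + \<Phi> Y) \<and>
     (\<forall>c. \<forall>X\<in>carrier_mat d d. \<Phi> (c \<cdot>\<^sub>m X) = c \<cdot>\<^sub>m \<Phi> X)"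

text \<open>The order on \<^typ>\<open>complex\<close> is the one of \<^theory>\<open>HOL-Library.Complex_Order\<close>: \<open>0 \<le> z\<close> means
  that \<open>z\<close> is real and nonnegative.\<close>

definition positive_semidefinite :: "nat \<Rightarrow> complex mat \<Rightarrow> bool" where
  "positive_semidefinite n A \<longleftrightarrow>
     A \<in> carrier_mat n n \<and> mat_adjoint A = A \<and>
     (\<forall>v\<in>carrier_vec n. 0 \<le> (A *\<^sub>v v) \<bullet>c v)"

definition positive_map :: "nat \<Rightarrow> (complex mat \<Rightarrow> complex mat) \<Rightarrow> bool" where
  "positive_map n \<Phi> \<longleftrightarrow>
     (\<forall>X. positive_semidefinite n X \<longrightarrow> positive_semidefinite n (\<Phi> X))"

text \<open>\<open>M\<^sub>k \<otimes> M\<^sub>d\<close> is identified with \<^term>\<open>carrier_mat (k * d) (k * d)\<close> by the Kronecker product,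
  so that an element is a \<open>k \<times> k\<close> array of \<open>d \<times> d\<close> blocks and the index pair \<open>(i, a)\<close> with \<open>i < k\<close>,
  \<open>a < d\<close> is encoded as \<open>i * d + a\<close>. With \<open>E\<^sub>i\<^sub>j\<close> the matrix units of \<open>M\<^sub>k\<close>, the matrix
  \<open>X = \<Sum> E\<^sub>i\<^sub>j \<otimes> X\<^sub>i\<^sub>j\<close> is sent by \<open>id \<otimes> \<Phi>\<close> to \<open>\<Sum> E\<^sub>i\<^sub>j \<otimes> \<Phi> X\<^sub>i\<^sub>j\<close>; that is, \<open>\<Phi>\<close> acts on each block.
  The lemma \<open>id_tensor_kronecker\<close> below relates this to elementary tensors.\<close>

definition kronecker :: "complex mat \<Rightarrow> complex mat \<Rightarrow> complex mat" where
  "kronecker A B = mat (dim_row A * dim_row B) (dim_col A * dim_col B)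
     (\<lambda>(p, q). A $$ (p div dim_row B, q div dim_col B) * B $$ (p mod dim_row B, q mod dim_col B))"

definition mat_block :: "nat \<Rightarrow> complex mat \<Rightarrow> nat \<Rightarrow> nat \<Rightarrow> complex mat" where
  "mat_block d X i j = mat d d (\<lambda>(a, b). X $$ (i * d + a, j * d + b))"

definition id_tensor ::
  "nat \<Rightarrow> nat \<Rightarrow> (complex mat \<Rightarrow> complex mat) \<Rightarrow> complex mat \<Rightarrow> complex mat" where
  "id_tensor k d \<Phi> X = mat (k * d) (k * d)
     (\<lambda>(p, q). \<Phi> (mat_block d X (p div d) (q div d)) $$ (p mod d, q mod d))"

definition k_positive :: "nat \<Rightarrow> nat \<Rightarrow> (complex mat \<Rightarrow> complex mat) \<Rightarrow> bool" where
  "k_positive k d \<Phi> \<longleftrightarrow> positive_map (k * d) (id_tensor k d \<Phi>)"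

definition mat_trace :: "complex mat \<Rightarrow> complex" where
  "mat_trace X = (\<Sum>i<dim_row X. X $$ (i, i))"

definition tau0 :: "nat \<Rightarrow> complex mat \<Rightarrow> complex mat" where
  "tau0 d X = (1 / of_nat d * mat_trace X) \<cdot>\<^sub>m 1\<^sub>m d"

definition diag_part :: "nat \<Rightarrow> complex mat \<Rightarrow> complex mat" where
  "diag_part d X = mat_diag d (\<lambda>i. X $$ (i, i))"

definition Lambda_map :: "nat \<Rightarrow> real \<Rightarrow> real \<Rightarrow> complex mat \<Rightarrow> complex mat" where
  "Lambda_map d \<mu> \<nu> X =
     complex_of_real (1 - \<mu> - \<nu>) \<cdot>\<^sub>m transpose_mat X
     + complex_of_real \<mu> \<cdot>\<^sub>m tau0 d X
     + complex_of_real \<nu> \<cdot>\<^sub>m diag_part d X"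

lemma linear_on_mat_Lambda_map: "linear_on_mat d (Lambda_map d \<mu> \<nu>)"
  unfolding linear_on_mat_def
proof (intro conjI ballI allI)
  fix X Y :: "complex mat" and c :: complex
  assume X: "X \<in> carrier_mat d d"
  show "Lambda_map d \<mu> \<nu> X \<in> carrier_mat d d"
    using X by (auto simp: Lambda_map_def tau0_def diag_part_def mat_diag_def)
  show "Lambda_map d \<mu> \<nu> (c \<cdot>\<^sub>m X) = c \<cdot>\<^sub>m Lambda_map d \<mu> \<nu> X"
    using X by (intro eq_matI)
      (auto simp: Lambda_map_def tau0_def diag_part_def mat_diag_def mat_trace_def
        sum_distrib_left algebra_simps)
  assume Y: "Y \<in> carrier_mat d d"
  show "Lambda_map d \<mu> \<nu> (X + Y) = Lambda_map d \<mu> \<nu> X + Lambda_map d \<mu> \<nu> Y"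
    using X Y by (intro eq_matI)
      (auto simp: Lambda_map_def tau0_def diag_part_def mat_diag_def mat_trace_def
        sum.distrib add_divide_distrib algebra_simps)
qed

lemma id_tensor_kronecker:
  assumes \<Phi>: "linear_on_mat d \<Phi>" and A: "A \<in> carrier_mat k k" and B: "B \<in> carrier_mat d d"
  shows "id_tensor k d \<Phi> (kronecker A B) = kronecker A (\<Phi> B)"
proof (rule eq_matI)
  have \<Phi>B: "\<Phi> B \<in> carrier_mat d d"
    using \<Phi> B by (auto simp: linear_on_mat_def)
  show "dim_row (id_tensor k d \<Phi> (kronecker A B)) = dim_row (kronecker A (\<Phi> B))"
    "dim_col (id_tensor k d \<Phi> (kronecker A B)) = dim_col (kronecker A (\<Phi> B))"
    using A \<Phi>B by (auto simp: id_tensor_def kronecker_def)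
  fix p q assume "p < dim_row (kronecker A (\<Phi> B))" "q < dim_col (kronecker A (\<Phi> B))"
  then have p: "p < k * d" and q: "q < k * d"
    using A \<Phi>B by (auto simp: kronecker_def)
  then have d: "d > 0" by (cases d) auto
  have pq: "p div d < k" "q div d < k" "p mod d < d" "q mod d < d"
    using p q d by (auto simp: less_mult_imp_div_less)
  have bound: "i * d + a < k * d" if "i < k" "a < d" for i a
  proof -
    have "i * d + a < Suc i * d" using that by simp
    also have "\<dots> \<le> k * d" using that by (intro mult_le_mono1) simp
    finally show ?thesis .
  qed
  have "mat_block d (kronecker A B) (p div d) (q div d) = A $$ (p div d, q div d) \<cdot>\<^sub>m B"
    using A B pq bound by (intro eq_matI) (auto simp: mat_block_def kronecker_def)
  then have "\<Phi> (mat_block d (kronecker A B) (p div d) (q div d))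
      = A $$ (p div d, q div d) \<cdot>\<^sub>m \<Phi> B"
    using \<Phi> B by (simp add: linear_on_mat_def)
  then show "id_tensor k d \<Phi> (kronecker A B) $$ (p, q) = kronecker A (\<Phi> B) $$ (p, q)"
    using A \<Phi>B p q pq by (simp add: id_tensor_def kronecker_def)
qed

end

theory Submission
  imports Defs
begin

text \<open>
  For \<open>v = \<Sum>\<^sub>i e\<^sub>i \<otimes> v\<^sub>i\<close> put \<open>w\<^sub>a\<^sub>b = \<Sum>\<^sub>i v\<^sub>i(a) e\<^sub>i \<otimes> e\<^sub>b\<close>, and let \<open>B\<close> be the sesquilinear form of \<open>X\<close>.
  The quadratic form of \<open>(id \<otimes> \<Lambda>) X\<close> at \<open>v\<close> is \<open>(1 - \<mu> - \<nu>) S + (\<mu>/d) P + \<nu> Q\<close>, where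
  \<open>S = \<Sum> B(w\<^sub>a\<^sub>b, w\<^sub>b\<^sub>a)\<close>, \<open>P = \<Sum> B(w\<^sub>a\<^sub>b, w\<^sub>a\<^sub>b)\<close> and \<open>Q = \<Sum> B(w\<^sub>a\<^sub>a, w\<^sub>a\<^sub>a)\<close>. If \<open>X\<close> is positive
  semidefinite, evaluating \<open>B\<close> at \<open>w\<^sub>a\<^sub>b \<plusminus> w\<^sub>b\<^sub>a\<close> and \<open>w\<^sub>a\<^sub>a\<close> gives \<open>P \<ge> S\<close>, \<open>P + S \<ge> 2 Q\<close> and \<open>Q \<ge> 0\<close>; for
  \<open>k = 1\<close> the conjugate of \<open>v\<close> gives in addition \<open>0 \<le> S \<le> d Q\<close>. The parameter region is in each case
  the set where the form is a nonnegative combination of these inequalities. Conversely,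
  each bound on the parameters is read off from one real rank one \<open>X\<close> and a real \<open>v\<close>, for which the
  matrix \<open>\<Sum>\<^sub>i v\<^sub>i z\<^sub>i\<^sup>T\<close> (with \<open>X = z z\<^sup>T\<close>) has rank at most \<open>min k 2\<close>.
\<close>

section \<open>Block indices and the sesquilinear form of a matrix\<close>

lemma sum_lessThan_mult:
  fixes f :: "nat \<Rightarrow> 'a::comm_monoid_add"
  shows "(\<Sum>p<k * d. f p) = (\<Sum>i<k. \<Sum>a<d. f (i * d + a))"
proof -
  have "(\<Sum>p<k * d. f p) = (\<Sum>i<k. sum f {i * d..<i * d + d})"
    by (rule sum.nat_group[symmetric])
  also have "\<dots> = (\<Sum>i<k. \<Sum>a<d. f (i * d + a))"
  proof (rule sum.cong[OF refl])
    show "sum f {i * d..<i * d + d} = (\<Sum>a<d. f (i * d + a))" for i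
      using sum.shift_bounds_nat_ivl[of f 0 "i * d" d] by (simp add: atLeast0LessThan add.commute)
  qed
  finally show ?thesis .
qed

lemma block_index_less: "i < k \<Longrightarrow> a < d \<Longrightarrow> i * d + a < k * d" for i a k d :: nat
proof -
  assume "i < k" "a < d"
  then have "i * d + a < Suc i * d" by simp
  also have "\<dots> \<le> k * d" using \<open>i < k\<close> by (intro mult_le_mono1) simp
  finally show ?thesis .
qed

lemma mat_adjoint_eq_iff:
  assumes "A \<in> carrier_mat n n"
  shows "mat_adjoint A = A \<longleftrightarrow> (\<forall>p<n. \<forall>q<n. A $$ (q, p) = cnj (A $$ (p, q)))"
proof -
  have dim: "dim_row (mat_adjoint A) = n" "dim_col (mat_adjoint A) = n"
    using assms by (auto simp: mat_adjoint_def)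
  have entry: "mat_adjoint A $$ (q, p) = cnj (A $$ (p, q))" if "p < n" "q < n" for p q
    using assms that by (simp add: mat_adjoint_def mat_of_rows_def)
  have "mat_adjoint A = A \<longleftrightarrow> (\<forall>p<n. \<forall>q<n. mat_adjoint A $$ (q, p) = A $$ (q, p))"
    using assms dim by (auto simp: mat_eq_iff)
  also have "\<dots> \<longleftrightarrow> (\<forall>p<n. \<forall>q<n. A $$ (q, p) = cnj (A $$ (p, q)))"
    using entry by (metis (no_types))
  finally show ?thesis .
qed

lemma quad_form_eq_sum:
  fixes A :: "complex mat"
  assumes "A \<in> carrier_mat n n" "v \<in> carrier_vec n"
  shows "(A *\<^sub>v v) \<bullet>c v = (\<Sum>p<n. \<Sum>q<n. cnj (v $ p) * A $$ (p, q) * v $ q)"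
  using assms
  by (auto simp: scalar_prod_def sum_distrib_left sum_distrib_right atLeast0LessThan
      intro!: sum.cong)

lemma psd_sum_nonneg:
  assumes "positive_semidefinite n X"
  shows "0 \<le> (\<Sum>p<n. \<Sum>q<n. cnj (g p) * X $$ (p, q) * g q)"
proof -
  have X: "X \<in> carrier_mat n n"
    using assms by (auto simp: positive_semidefinite_def)
  have "0 \<le> (X *\<^sub>v vec n g) \<bullet>c vec n g"
    using assms by (auto simp: positive_semidefinite_def)
  also have "\<dots> = (\<Sum>p<n. \<Sum>q<n. cnj (g p) * X $$ (p, q) * g q)"
    by (subst quad_form_eq_sum[OF X]) auto
  finally show ?thesis .
qed

text \<open>\<open>amp_form k d X v a b c e\<close> is \<open>B(w\<^sub>a\<^sub>b, w\<^sub>c\<^sub>e)\<close>.\<close>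

definition amp_form ::
  "nat \<Rightarrow> nat \<Rightarrow> complex mat \<Rightarrow> complex vec \<Rightarrow> nat \<Rightarrow> nat \<Rightarrow> nat \<Rightarrow> nat \<Rightarrow> complex" where
  "amp_form k d X v a b c e =
     (\<Sum>i<k. \<Sum>j<k. cnj (v $ (i * d + a)) * X $$ (i * d + b, j * d + e) * v $ (j * d + c))"

text \<open>This expands \<open>B(u, u) \<ge> 0\<close> at \<open>u = w_ab + s w_ce\<close> with
  \<open>s\<close> real. The values \<open>s = 1\<close>, \<open>s = -1\<close> and
  \<open>s = 0\<close> are the source of all later inequalities.\<close>

lemma amp_form_square_nonneg:
  fixes s :: real
  assumes "positive_semidefinite (k * d) X" "b < d" "e < d"
  shows "0 \<le> amp_form k d X v a b a b
    + of_real s * (amp_form k d X v a b c e + amp_form k d X v c e a b)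
    + of_real (s\<^sup>2) * amp_form k d X v c e c e"
proof -
  \<comment> \<open>\<open>g\<close> lists the coordinates of \<open>w_ab + s w_ce\<close>. The two
    conditionals stay separate summands, so that \<open>b = e\<close> needs no case of its
    own.\<close>
  define g where "g p = (if p mod d = b then v $ (p div d * d + a) else 0)
    + of_real s * (if p mod d = e then v $ (p div d * d + c) else 0)" for p
  have "d > 0" using assms by auto
  have g: "g (i * d + x) = (if x = b then v $ (i * d + a) else 0)
    + of_real s * (if x = e then v $ (i * d + c) else 0)" if "x < d" for i x
    using that \<open>d > 0\<close> by (simp add: g_def)
  have collapse: "(\<Sum>x<d. (if x = b then f x else 0) + (if x = e then h x else 0)) = f b + h e"
    for f h :: "nat \<Rightarrow> complex"
    using assms by (simp add: sum.distrib)
  have inner: "(\<Sum>x<d. F x * g (j * d + x)) = F b * v $ (j * d + a) + of_real s * (F e * v $ (j * d + c))"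
    for F :: "nat \<Rightarrow> complex" and j
  proof -
    have "(\<Sum>x<d. F x * g (j * d + x)) = (\<Sum>x<d. (if x = b then F x * v $ (j * d + a) else 0)
        + (if x = e then of_real s * (F x * v $ (j * d + c)) else 0))"
      by (intro sum.cong refl) (simp only: g lessThan_iff, simp add: distrib_left)
    then show ?thesis by (simp only: collapse)
  qed
  have outer: "(\<Sum>x<d. cnj (g (i * d + x)) * F x)
      = cnj (v $ (i * d + a)) * F b + of_real s * (cnj (v $ (i * d + c)) * F e)"
    for F :: "nat \<Rightarrow> complex" and i
  proof -
    have "(\<Sum>x<d. cnj (g (i * d + x)) * F x) = (\<Sum>x<d. (if x = b then cnj (v $ (i * d + a)) * F x else 0)
        + (if x = e then of_real s * (cnj (v $ (i * d + c)) * F x) else 0))"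
      by (intro sum.cong refl) (simp only: g lessThan_iff, simp add: distrib_right)
    then show ?thesis by (simp only: collapse)
  qed
  have "0 \<le> (\<Sum>p<k * d. \<Sum>q<k * d. cnj (g p) * X $$ (p, q) * g q)"
    by (rule psd_sum_nonneg[OF assms(1)])
  also have "\<dots> = (\<Sum>i<k. \<Sum>x<d. cnj (g (i * d + x)) *
      (\<Sum>j<k. \<Sum>y<d. X $$ (i * d + x, j * d + y) * g (j * d + y)))"
    by (simp only: sum_lessThan_mult sum_distrib_left mult.assoc)
  also have "\<dots> = amp_form k d X v a b a b
    + of_real s * (amp_form k d X v a b c e + amp_form k d X v c e a b)
    + of_real (s\<^sup>2) * amp_form k d X v c e c e"
    unfolding inner outer
    by (simp only: amp_form_def sum.distrib sum_distrib_left distrib_left power2_eq_square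
        of_real_mult mult_ac add_ac)
  finally show ?thesis .
qed

section \<open>Entries and quadratic form of the amplified map\<close>

lemma Lambda_map_index:
  assumes "X \<in> carrier_mat d d" "a < d" "b < d"
  shows "Lambda_map d \<mu> \<nu> X $$ (a, b) = of_real (1 - \<mu> - \<nu>) * X $$ (b, a)
    + (if a = b then of_real (\<mu> / d) * (\<Sum>c<d. X $$ (c, c)) + of_real \<nu> * X $$ (a, a) else 0)"
  using assms by (auto simp: Lambda_map_def tau0_def diag_part_def mat_diag_def mat_trace_def)

text \<open>Transposing inside each block exchanges the inner indices \<open>p mod d\<close> and
  \<open>q mod d\<close> and keeps the block indices, so the first term is a partial transpose. The
  other two terms live on the diagonals of the blocks.\<close>

lemma id_tensor_Lambda_index:
  assumes "p < k * d" "q < k * d"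
  shows "id_tensor k d (Lambda_map d \<mu> \<nu>) X $$ (p, q) =
    of_real (1 - \<mu> - \<nu>) * X $$ (p div d * d + q mod d, q div d * d + p mod d)
    + (if p mod d = q mod d
       then of_real (\<mu> / d) * (\<Sum>c<d. X $$ (p div d * d + c, q div d * d + c))
         + of_real \<nu> * X $$ (p, q) else 0)"
proof -
  have "d > 0" using assms by (cases d) auto
  then have "p mod d < d" "q mod d < d" by auto
  moreover have "p = p div d * d + p mod d" "q = q div d * d + q mod d" by simp_all
  moreover have "p div d * d + q mod d = p" if "p mod d = q mod d"
    using that by (metis div_mult_mod_eq)
  ultimately show ?thesis
    using assms by (auto simp: id_tensor_def Lambda_map_index mat_block_def)
qed

text \<open>The coefficients are real, and for Hermitian \<open>X\<close> exchanging
  \<open>p\<close> and \<open>q\<close> conjugates each of the three terms of the entry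
  formula.\<close>

lemma id_tensor_Lambda_adjoint:
  assumes "X \<in> carrier_mat (k * d) (k * d)" "mat_adjoint X = X"
  shows "mat_adjoint (id_tensor k d (Lambda_map d \<mu> \<nu>) X) = id_tensor k d (Lambda_map d \<mu> \<nu>) X"
proof -
  have "id_tensor k d (Lambda_map d \<mu> \<nu>) X \<in> carrier_mat (k * d) (k * d)"
    by (simp add: id_tensor_def)
  moreover have herm: "X $$ (q, p) = cnj (X $$ (p, q))" if "p < k * d" "q < k * d" for p q
    using assms that mat_adjoint_eq_iff by blast
  have "id_tensor k d (Lambda_map d \<mu> \<nu>) X $$ (q, p) = cnj (id_tensor k d (Lambda_map d \<mu> \<nu>) X $$ (p, q))"
    if p: "p < k * d" and q: "q < k * d" for p q
  proof -
    have "d > 0" using p by (cases d) auto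
    then have bound: "p div d * d + c < k * d" "q div d * d + c < k * d" if "c < d" for c
      using that p q by (auto intro!: block_index_less simp: less_mult_imp_div_less)
    have "cnj (X $$ (p div d * d + q mod d, q div d * d + p mod d))
        = X $$ (q div d * d + p mod d, p div d * d + q mod d)"
      using \<open>d > 0\<close> by (intro herm[symmetric] bound) auto
    moreover have "(\<Sum>c<d. cnj (X $$ (p div d * d + c, q div d * d + c)))
        = (\<Sum>c<d. X $$ (q div d * d + c, p div d * d + c))"
      by (intro sum.cong refl herm[symmetric] bound) auto
    ultimately show ?thesis
      using herm[OF p q] by (simp add: id_tensor_Lambda_index p q)
  qed
  ultimately show ?thesis
    using mat_adjoint_eq_iff by blast
qed

text \<open>The partial transpose pairs \<open>w_ab\<close> with \<open>w_ba\<close>; the trace of a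
  block pairs each \<open>w_ab\<close> with itself; the diagonal part keeps only the
  \<open>w_aa\<close>.\<close>

lemma id_tensor_Lambda_quad_form:
  assumes "v \<in> carrier_vec (k * d)"
  shows "(id_tensor k d (Lambda_map d \<mu> \<nu>) X *\<^sub>v v) \<bullet>c v =
    of_real (1 - \<mu> - \<nu>) * (\<Sum>a<d. \<Sum>b<d. amp_form k d X v a b b a)
    + of_real (\<mu> / d) * (\<Sum>a<d. \<Sum>b<d. amp_form k d X v a b a b)
    + of_real \<nu> * (\<Sum>a<d. amp_form k d X v a a a a)"
proof -
  let ?Y = "id_tensor k d (Lambda_map d \<mu> \<nu>) X"
  let ?D = "\<lambda>a. of_real (\<mu> / d) * (\<Sum>b<d. amp_form k d X v a b a b) + of_real \<nu> * amp_form k d X v a a a a"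
  let ?F = "\<lambda>i a j b. cnj (v $ (i * d + a)) * ?Y $$ (i * d + a, j * d + b) * v $ (j * d + b)"
  have Y: "?Y \<in> carrier_mat (k * d) (k * d)" by (simp add: id_tensor_def)
  have entry: "(\<Sum>i<k. \<Sum>j<k. ?F i a j b) = of_real (1 - \<mu> - \<nu>) * amp_form k d X v a b b a
      + (if a = b then ?D a else 0)" if ab: "a < d" "b < d" for a b
  proof -
    have Yab: "?Y $$ (i * d + a, j * d + b) = of_real (1 - \<mu> - \<nu>) * X $$ (i * d + b, j * d + a)
        + (if a = b then of_real (\<mu> / d) * (\<Sum>c<d. X $$ (i * d + c, j * d + c))
         + of_real \<nu> * X $$ (i * d + a, j * d + b) else 0)" if "i < k" "j < k" for i j
      using ab that by (subst id_tensor_Lambda_index) (auto intro!: block_index_less)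
    have swap: "(\<Sum>c<d. amp_form k d X v a c a c) = (\<Sum>i<k. \<Sum>j<k. \<Sum>c<d.
        cnj (v $ (i * d + a)) * X $$ (i * d + c, j * d + c) * v $ (j * d + a))"
      unfolding amp_form_def
      by (subst sum.swap, rule sum.cong[OF refl], subst sum.swap, rule refl)
    have "(\<Sum>i<k. \<Sum>j<k. ?F i a j b) = (\<Sum>i<k. \<Sum>j<k.
        of_real (1 - \<mu> - \<nu>) * (cnj (v $ (i * d + a)) * X $$ (i * d + b, j * d + a) * v $ (j * d + b))
        + (if a = b then of_real (\<mu> / d) * (\<Sum>c<d.
              cnj (v $ (i * d + a)) * X $$ (i * d + c, j * d + c) * v $ (j * d + a))
            + of_real \<nu> * (cnj (v $ (i * d + a)) * X $$ (i * d + a, j * d + a) * v $ (j * d + a))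
           else 0))"
    proof (intro sum.cong refl)
      fix i j assume "i \<in> {..<k}" "j \<in> {..<k}"
      then have ij: "i < k" "j < k" by auto
      have distrib: "w * (\<alpha> * x + (if a = b then m * (\<Sum>c<d. h c) + n * y else 0)) * z
          = \<alpha> * (w * x * z) + (if a = b then m * (\<Sum>c<d. w * h c * z) + n * (w * y * z) else 0)"
        for w x y z \<alpha> m n :: complex and h
        by (simp add: algebra_simps flip: sum_distrib_left)
      show "?F i a j b = of_real (1 - \<mu> - \<nu>) * (cnj (v $ (i * d + a)) * X $$ (i * d + b, j * d + a) * v $ (j * d + b))
        + (if a = b then of_real (\<mu> / d) * (\<Sum>c<d.
              cnj (v $ (i * d + a)) * X $$ (i * d + c, j * d + c) * v $ (j * d + a))
            + of_real \<nu> * (cnj (v $ (i * d + a)) * X $$ (i * d + a, j * d + a) * v $ (j * d + a))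
           else 0)"
        unfolding Yab[OF ij] distrib by (cases "a = b") simp_all
    qed
    also have "\<dots> = of_real (1 - \<mu> - \<nu>) * amp_form k d X v a b b a + (if a = b then ?D a else 0)"
      unfolding swap
      by (cases "a = b") (simp_all only: amp_form_def sum.distrib sum_distrib_left simp_thms if_True if_False
          add_0_right sum.neutral_const)
    finally show ?thesis .
  qed
  \<comment> \<open>The inner indices \<open>a\<close>, \<open>b\<close> are moved outside the block
    indices, so that the double sum over blocks becomes a value of \<open>amp_form\<close>.\<close>
  have "(?Y *\<^sub>v v) \<bullet>c v = (\<Sum>i<k. \<Sum>a<d. \<Sum>j<k. \<Sum>b<d. ?F i a j b)"
    by (simp only: quad_form_eq_sum[OF Y assms] sum_lessThan_mult)
  also have "\<dots> = (\<Sum>a<d. \<Sum>i<k. \<Sum>b<d. \<Sum>j<k. ?F i a j b)"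
    by (subst sum.swap) (intro sum.cong refl sum.swap)
  also have "\<dots> = (\<Sum>a<d. \<Sum>b<d. \<Sum>i<k. \<Sum>j<k. ?F i a j b)"
    by (intro sum.cong refl sum.swap)
  also have "\<dots> = (\<Sum>a<d. \<Sum>b<d. of_real (1 - \<mu> - \<nu>) * amp_form k d X v a b b a
      + (if a = b then ?D a else 0))"
    by (intro sum.cong refl entry) auto
  also have "\<dots> = (\<Sum>a<d. (\<Sum>b<d. of_real (1 - \<mu> - \<nu>) * amp_form k d X v a b b a) + ?D a)"
    by (intro sum.cong refl) (simp add: sum.distrib)
  finally show ?thesis
    by (simp only: sum.distrib sum_distrib_left add.assoc)
qed

section \<open>Inequalities between P, S and Q\<close>

lemma complex_scale_nonneg: "0 \<le> c \<Longrightarrow> 0 \<le> z \<Longrightarrow> 0 \<le> complex_of_real c * z"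
  by (simp add: less_eq_complex_def)

text \<open>Under the flip of \<open>w_ab\<close> and \<open>w_ba\<close>, \<open>P - S\<close> and
  \<open>P + S\<close> are twice the sums of \<open>B(u, u)\<close> over the antisymmetric and the
  symmetric parts \<open>u\<close>. The diagonal vectors \<open>w_aa\<close> are symmetric and
  account for \<open>2 * Q\<close> of the latter.\<close>

lemma
  fixes X :: "complex mat" and v :: "complex vec"
  assumes X: "positive_semidefinite (k * d) X"
  defines "P \<equiv> \<Sum>a<d. \<Sum>b<d. amp_form k d X v a b a b"
    and "S \<equiv> \<Sum>a<d. \<Sum>b<d. amp_form k d X v a b b a"
    and "Q \<equiv> \<Sum>a<d. amp_form k d X v a a a a"
  shows amp_form_diag_nonneg: "0 \<le> Q"
    and amp_form_antisym_nonneg: "0 \<le> P - S"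
    and amp_form_sym_nonneg: "0 \<le> P + S - 2 * Q"
proof -
  show "0 \<le> Q"
    unfolding Q_def using amp_form_square_nonneg[OF X, where s = 0] by (intro sum_nonneg) auto
  have P': "(\<Sum>a<d. \<Sum>b<d. amp_form k d X v b a b a) = P"
    and S': "(\<Sum>a<d. \<Sum>b<d. amp_form k d X v b a a b) = S"
    unfolding P_def S_def by (rule sum.swap)+
  have "0 \<le> (\<Sum>a<d. \<Sum>b<d. amp_form k d X v a b a b
      + (- amp_form k d X v a b b a - amp_form k d X v b a a b) + amp_form k d X v b a b a)"
    using amp_form_square_nonneg[OF X, where s = "-1"] by (intro sum_nonneg) auto
  also have "\<dots> = complex_of_real 2 * (P - S)"
    by (simp add: sum.distrib sum_subtractf sum_negf P' S' flip: P_def S_def)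
  finally show "0 \<le> P - S"
    by (simp add: less_eq_complex_def)
  \<comment> \<open>The terms with \<open>a = b\<close> are dropped: each would contribute
    \<open>4 B(w_aa, w_aa)\<close>, and only \<open>P + S \<ge> 0\<close> would result. In the
    antisymmetric sum they vanish by themselves.\<close>
  have "0 \<le> (\<Sum>a<d. \<Sum>b<d. if a = b then 0 else amp_form k d X v a b a b
      + (amp_form k d X v a b b a + amp_form k d X v b a a b) + amp_form k d X v b a b a)"
    using amp_form_square_nonneg[OF X, where s = 1] by (intro sum_nonneg) auto
  also have "\<dots> = (\<Sum>a<d. \<Sum>b<d. amp_form k d X v a b a b
      + (amp_form k d X v a b b a + amp_form k d X v b a a b) + amp_form k d X v b a b a
      - (if a = b then 4 * amp_form k d X v a a a a else 0))"
    by (intro sum.cong refl) auto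
  also have "\<dots> = complex_of_real 2 * (P + S - 2 * Q)"
    by (simp add: sum.distrib sum_subtractf sum_negf P' S' flip: P_def S_def)
      (simp add: Q_def sum_distrib_left)
  finally show "0 \<le> P + S - 2 * Q"
    by (simp add: less_eq_complex_def)
qed

text \<open>With a single block, \<open>S\<close> is the form of \<open>X\<close> at the conjugate
  \<open>w\<close> of \<open>v\<close>, whence \<open>S \<ge> 0\<close>. Splitting \<open>w\<close>
  into its \<open>d\<close> coordinate vectors, \<open>S\<close> is \<open>B\<close> at their sum
  and \<open>Q\<close> the sum of \<open>B\<close> at each, so \<open>S \<le> d * Q\<close> is
  Cauchy-Schwarz, obtained by summing \<open>B\<close> at all pairwise differences.\<close>

lemma
  fixes X :: "complex mat" and v :: "complex vec"
  assumes X: "positive_semidefinite d X" and v: "v \<in> carrier_vec d"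
  defines "S \<equiv> \<Sum>a<d. \<Sum>b<d. amp_form 1 d X v a b b a"
    and "Q \<equiv> \<Sum>a<d. amp_form 1 d X v a a a a"
  shows amp_form_swap_nonneg: "0 \<le> S"
    and amp_form_swap_le_diag: "0 \<le> of_nat d * Q - S"
proof -
  define w where "w = vec d (\<lambda>a. cnj (v $ a))"
  have conj: "amp_form 1 d X w a a b b = amp_form 1 d X v b a a b" if "a < d" "b < d" for a b
    using that by (simp add: amp_form_def w_def)
  have S': "(\<Sum>a<d. \<Sum>b<d. amp_form 1 d X v b a a b) = S"
    unfolding S_def by (rule sum.swap)
  have "S = (\<Sum>a<d. \<Sum>b<d. cnj (w $ a) * X $$ (a, b) * w $ b)"
    unfolding S'[symmetric] by (simp add: amp_form_def w_def mult_ac)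
  then show "0 \<le> S"
    using psd_sum_nonneg[OF X] by simp
  have "0 \<le> (\<Sum>a<d. \<Sum>b<d. amp_form 1 d X w a a a a
      + (- amp_form 1 d X w a a b b - amp_form 1 d X w b b a a) + amp_form 1 d X w b b b b)"
    using amp_form_square_nonneg[of 1 d X, where s = "-1"] X by (intro sum_nonneg) auto
  also have "\<dots> = (\<Sum>a<d. \<Sum>b<d. amp_form 1 d X v a a a a
      + (- amp_form 1 d X v b a a b - amp_form 1 d X v a b b a) + amp_form 1 d X v b b b b)"
    by (intro sum.cong refl) (simp add: conj del: One_nat_def)
  also have "\<dots> = complex_of_real 2 * (of_nat d * Q - S)"
    by (simp add: sum.distrib sum_subtractf sum_negf S' del: One_nat_def
        flip: S_def Q_def sum_distrib_left)
  finally show "0 \<le> of_nat d * Q - S"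
    by (simp add: less_eq_complex_def)
qed

section \<open>Sufficiency of the bounds\<close>

lemma id_tensor_Lambda_psd:
  assumes X: "positive_semidefinite (k * d) X"
    and form: "\<And>v. v \<in> carrier_vec (k * d) \<Longrightarrow>
      0 \<le> of_real (1 - \<mu> - \<nu>) * (\<Sum>a<d. \<Sum>b<d. amp_form k d X v a b b a)
        + of_real (\<mu> / d) * (\<Sum>a<d. \<Sum>b<d. amp_form k d X v a b a b)
        + of_real \<nu> * (\<Sum>a<d. amp_form k d X v a a a a)"
  shows "positive_semidefinite (k * d) (id_tensor k d (Lambda_map d \<mu> \<nu>) X)"
  unfolding positive_semidefinite_def
proof (intro conjI ballI)
  show "id_tensor k d (Lambda_map d \<mu> \<nu>) X \<in> carrier_mat (k * d) (k * d)"
    by (simp add: id_tensor_def)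
  show "mat_adjoint (id_tensor k d (Lambda_map d \<mu> \<nu>) X) = id_tensor k d (Lambda_map d \<mu> \<nu>) X"
    using X by (intro id_tensor_Lambda_adjoint) (auto simp: positive_semidefinite_def)
qed (simp only: id_tensor_Lambda_quad_form form)

text \<open>Matching the coefficients of \<open>P\<close>, \<open>S\<close> and \<open>Q\<close>
  forces the weights of the three inequalities valid for every \<open>k\<close>; the hypotheses say
  that these weights are nonnegative.\<close>

lemma k_positive_Lambda_map:
  assumes "\<bar>1 - \<mu> - \<nu>\<bar> \<le> \<mu> / d" "0 \<le> 1 - \<mu> + \<mu> / d"
  shows "k_positive k d (Lambda_map d \<mu> \<nu>)"
  unfolding k_positive_def positive_map_def
proof (intro allI impI id_tensor_Lambda_psd)
  fix X and v :: "complex vec" assume X: "positive_semidefinite (k * d) X"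
  define \<alpha> m where "\<alpha> = 1 - \<mu> - \<nu>" and "m = \<mu> / d"
  have coeffs: "0 \<le> (m + \<alpha>) / 2" "0 \<le> (m - \<alpha>) / 2" "0 \<le> \<alpha> + m + \<nu>"
    using assms by (auto simp: \<alpha>_def m_def abs_le_iff)
  define P S Q where "P = (\<Sum>a<d. \<Sum>b<d. amp_form k d X v a b a b)"
    and "S = (\<Sum>a<d. \<Sum>b<d. amp_form k d X v a b b a)"
    and "Q = (\<Sum>a<d. amp_form k d X v a a a a)"
  have "0 \<le> complex_of_real ((m + \<alpha>) / 2) * (P + S - 2 * Q)
      + complex_of_real ((m - \<alpha>) / 2) * (P - S) + complex_of_real (\<alpha> + m + \<nu>) * Q"
    unfolding P_def S_def Q_def
    by (intro add_nonneg_nonneg complex_scale_nonneg coeffs amp_form_diag_nonneg[OF X]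
        amp_form_antisym_nonneg[OF X] amp_form_sym_nonneg[OF X])
  also have "\<dots> = of_real \<alpha> * S + of_real m * P + of_real \<nu> * Q"
    by (simp add: field_simps)
  finally show "0 \<le> of_real (1 - \<mu> - \<nu>) * (\<Sum>a<d. \<Sum>b<d. amp_form k d X v a b b a)
      + of_real (\<mu> / d) * (\<Sum>a<d. \<Sum>b<d. amp_form k d X v a b a b)
      + of_real \<nu> * (\<Sum>a<d. amp_form k d X v a a a a)"
    by (simp only: \<alpha>_def m_def P_def S_def Q_def)
qed

text \<open>This makes positivity the case \<open>k = 1\<close>, so that the same quadratic form
  serves both claims.\<close>

lemma k_positive_1_iff_positive_map:
  assumes "linear_on_mat d \<Phi>"
  shows "k_positive 1 d \<Phi> \<longleftrightarrow> positive_map d \<Phi>"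
proof -
  have "id_tensor 1 d \<Phi> X = \<Phi> X" if "X \<in> carrier_mat d d" for X
  proof -
    have "mat_block d X 0 0 = X"
      using that by (auto simp: mat_block_def)
    moreover have "\<Phi> X \<in> carrier_mat d d"
      using assms that by (simp add: linear_on_mat_def)
    ultimately show ?thesis
      by (auto simp: id_tensor_def)
  qed
  then show ?thesis
    unfolding k_positive_def positive_map_def by (auto simp: positive_semidefinite_def)
qed

text \<open>The sign of \<open>\<nu>\<close> decides whether \<open>Q\<close> has to be bounded from
  below or from above. After that, \<open>P \<ge> S\<close> and \<open>S \<ge> 0\<close> finish both
  cases.\<close>

lemma positive_Lambda_map:
  assumes d: "d > 0" and \<mu>: "0 \<le> \<mu>" "0 \<le> 1 - \<mu> + \<mu> / d"
    and \<nu>: "0 \<le> 2 * (\<mu> / d) + \<nu>" "0 \<le> 1 - \<mu> - \<nu> + \<mu> / d + \<nu> / d"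
  shows "k_positive 1 d (Lambda_map d \<mu> \<nu>)"
  unfolding k_positive_def positive_map_def
proof (intro allI impI id_tensor_Lambda_psd)
  fix X and v :: "complex vec" assume X: "positive_semidefinite (1 * d) X" and v: "v \<in> carrier_vec (1 * d)"
  define \<alpha> m where "\<alpha> = 1 - \<mu> - \<nu>" and "m = \<mu> / d"
  have coeffs: "0 \<le> m" "0 \<le> m + \<nu> / 2" "0 \<le> \<alpha> + m + \<nu>" "0 \<le> \<alpha> + m + \<nu> / d"
    using \<mu> \<nu> by (simp add: m_def, unfold \<alpha>_def m_def, linarith+)
  define P S Q where "P = (\<Sum>a<d. \<Sum>b<d. amp_form 1 d X v a b a b)"
    and "S = (\<Sum>a<d. \<Sum>b<d. amp_form 1 d X v a b b a)"
    and "Q = (\<Sum>a<d. amp_form 1 d X v a a a a)"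
  have ineqs: "0 \<le> S" "0 \<le> of_nat d * Q - S" "0 \<le> P - S" "0 \<le> P + S - 2 * Q"
    unfolding P_def S_def Q_def
    by (rule amp_form_swap_nonneg[OF X[simplified] v[simplified]]
        amp_form_swap_le_diag[OF X[simplified] v[simplified]]
        amp_form_antisym_nonneg[OF X] amp_form_sym_nonneg[OF X])+
  have "0 \<le> of_real \<alpha> * S + of_real m * P + of_real \<nu> * Q"
  proof (cases "0 \<le> \<nu>")
    \<comment> \<open>Here \<open>Q \<ge> S / d\<close> bounds the term \<open>\<nu> * Q\<close>
      from below.\<close>
    case True
    have "0 \<le> complex_of_real (\<alpha> + m + \<nu> / d) * S + complex_of_real (\<nu> / d) * (of_nat d * Q - S)
        + complex_of_real m * (P - S)"
      using True by (intro add_nonneg_nonneg complex_scale_nonneg[OF coeffs(4) ineqs(1)]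
          complex_scale_nonneg[OF _ ineqs(2)] complex_scale_nonneg[OF coeffs(1) ineqs(3)]) simp
    also have "\<dots> = of_real \<alpha> * S + of_real m * P + of_real \<nu> * Q"
      using d by (simp add: field_simps)
    finally show ?thesis .
  next
    \<comment> \<open>Here \<open>Q \<le> (P + S) / 2\<close> bounds the term
      \<open>\<nu> * Q\<close> from below.\<close>
    case False
    have "0 \<le> complex_of_real (\<alpha> + m + \<nu>) * S + complex_of_real (- \<nu> / 2) * (P + S - 2 * Q)
        + complex_of_real (m + \<nu> / 2) * (P - S)"
      using False by (intro add_nonneg_nonneg complex_scale_nonneg[OF coeffs(3) ineqs(1)]
          complex_scale_nonneg[OF _ ineqs(4)] complex_scale_nonneg[OF coeffs(2) ineqs(3)]) simp
    also have "\<dots> = of_real \<alpha> * S + of_real m * P + of_real \<nu> * Q"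
      by (simp add: field_simps)
    finally show ?thesis .
  qed
  then show "0 \<le> of_real (1 - \<mu> - \<nu>) * (\<Sum>a<d. \<Sum>b<d. amp_form 1 d X v a b b a)
      + of_real (\<mu> / d) * (\<Sum>a<d. \<Sum>b<d. amp_form 1 d X v a b a b)
      + of_real \<nu> * (\<Sum>a<d. amp_form 1 d X v a a a a)"
    by (simp only: \<alpha>_def m_def P_def S_def Q_def)
qed


section \<open>Necessity of the bounds, by real rank one test matrices\<close>

text \<open>For \<open>X = z z^T\<close> and \<open>v = y\<close> the form factors as
  \<open>B(w_ab, w_ce) = G a b * G c e\<close>. Thus \<open>S\<close>, \<open>P\<close> and
  \<open>Q\<close> become the trace of \<open>G^2\<close>, the squared Frobenius norm of
  \<open>G\<close> and the squared norm of its diagonal.\<close>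

lemma k_positive_Lambda_map_rank_one:
  fixes y z :: "nat \<Rightarrow> nat \<Rightarrow> real"
  assumes "k_positive k d (Lambda_map d \<mu> \<nu>)"
  defines "G \<equiv> \<lambda>a b. \<Sum>i<k. y i a * z i b"
  shows "0 \<le> (1 - \<mu> - \<nu>) * (\<Sum>a<d. \<Sum>b<d. G a b * G b a) + \<mu> / d * (\<Sum>a<d. \<Sum>b<d. (G a b)\<^sup>2)
    + \<nu> * (\<Sum>a<d. (G a a)\<^sup>2)"
proof -
  define \<zeta> where "\<zeta> p = complex_of_real (z (p div d) (p mod d))" for p
  define X where "X = mat (k * d) (k * d) (\<lambda>(p, q). \<zeta> p * \<zeta> q)"
  define v where "v = vec (k * d) (\<lambda>p. complex_of_real (y (p div d) (p mod d)))"
  have X_carrier: "X \<in> carrier_mat (k * d) (k * d)" and v_carrier: "v \<in> carrier_vec (k * d)"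
    by (simp_all add: X_def v_def)
  have cnj_nonneg: "0 \<le> cnj w * w" for w
    by (simp add: less_eq_complex_def)
  have "0 \<le> (X *\<^sub>v u) \<bullet>c u" if u: "u \<in> carrier_vec (k * d)" for u
  proof -
    \<comment> \<open>As \<open>\<zeta>\<close> is real, the form is the squared modulus of one
      linear functional of \<open>u\<close>.\<close>
    have "(X *\<^sub>v u) \<bullet>c u = (\<Sum>p<k * d. \<Sum>q<k * d. cnj (\<zeta> p * u $ p) * (\<zeta> q * u $ q))"
      unfolding quad_form_eq_sum[OF X_carrier u]
      by (intro sum.cong refl) (simp add: X_def \<zeta>_def)
    also have "\<dots> = cnj (\<Sum>p<k * d. \<zeta> p * u $ p) * (\<Sum>p<k * d. \<zeta> p * u $ p)"
      by (simp only: cnj_sum sum_product)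
    also have "\<dots> \<ge> 0"
      using cnj_nonneg .
    finally show ?thesis .
  qed
  moreover have "mat_adjoint X = X"
    unfolding mat_adjoint_eq_iff[OF X_carrier] by (simp add: X_def \<zeta>_def mult.commute)
  ultimately have "positive_semidefinite (k * d) X"
    using X_carrier by (simp add: positive_semidefinite_def)
  then have "positive_semidefinite (k * d) (id_tensor k d (Lambda_map d \<mu> \<nu>) X)"
    using assms by (simp add: k_positive_def positive_map_def)
  then have "0 \<le> (id_tensor k d (Lambda_map d \<mu> \<nu>) X *\<^sub>v v) \<bullet>c v"
    using v_carrier by (simp add: positive_semidefinite_def)
  moreover have "amp_form k d X v a b c e = complex_of_real (G a b * G c e)"
    if "a < d" "b < d" "c < d" "e < d" for a b c e
  proof -
    have "amp_form k d X v a b c e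
        = (\<Sum>i<k. \<Sum>j<k. complex_of_real (y i a * z i b * (y j c * z j e)))"
      unfolding amp_form_def
      by (intro sum.cong refl) (use that in \<open>simp add: X_def v_def \<zeta>_def block_index_less\<close>)
    then show ?thesis
      by (simp only: G_def sum_product of_real_sum)
  qed
  ultimately show ?thesis
    by (simp add: id_tensor_Lambda_quad_form[OF v_carrier] less_eq_complex_def power2_eq_square
        flip: of_real_mult of_real_sum of_real_add)
qed

text \<open>With \<open>y\<close> placed in block 0 alone, \<open>G\<close> is the product
  \<open>y z^T\<close>.\<close>

lemma k_positive_Lambda_map_product:
  fixes y z :: "nat \<Rightarrow> real"
  assumes "k_positive k d (Lambda_map d \<mu> \<nu>)" "1 \<le> k"
  shows "0 \<le> (1 - \<mu> - \<nu>) * (\<Sum>a<d. \<Sum>b<d. y a * z b * (y b * z a))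
    + \<mu> / d * (\<Sum>a<d. \<Sum>b<d. (y a * z b)\<^sup>2) + \<nu> * (\<Sum>a<d. (y a * z a)\<^sup>2)"
proof -
  have "(\<Sum>i<k. (if i = 0 then y a else 0) * z b) = y a * z b" for a b
    using assms(2) by (simp add: if_distrib[of "\<lambda>x. x * _"] cong: if_cong)
  then show ?thesis
    using k_positive_Lambda_map_rank_one[OF assms(1), of "\<lambda>i a. if i = 0 then y a else 0" "\<lambda>_. z"]
    by simp
qed

lemma k_positive_Lambda_map_rank_two:
  fixes y z y' z' :: "nat \<Rightarrow> real"
  assumes "k_positive k d (Lambda_map d \<mu> \<nu>)" "2 \<le> k"
  defines "G \<equiv> \<lambda>a b. y a * z b + y' a * z' b"
  shows "0 \<le> (1 - \<mu> - \<nu>) * (\<Sum>a<d. \<Sum>b<d. G a b * G b a) + \<mu> / d * (\<Sum>a<d. \<Sum>b<d. (G a b)\<^sup>2)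
    + \<nu> * (\<Sum>a<d. (G a a)\<^sup>2)"
proof -
  \<comment> \<open>Blocks 0 and 1 carry the two products. From block 2 on \<open>Y\<close>
    vanishes, so the value of \<open>Z\<close> there drops out.\<close>
  define Y Z where "Y i = (if i = 0 then y else if i = 1 then y' else (\<lambda>_. 0))"
    and "Z i = (if i = 0 then z else z')" for i :: nat
  have "(\<Sum>i<k. Y i a * Z i b) = (\<Sum>i\<in>{0, 1}. Y i a * Z i b)" for a b
    using assms(2) by (intro sum.mono_neutral_right) (auto simp: Y_def)
  then have "(\<Sum>i<k. Y i a * Z i b) = G a b" for a b
    by (simp add: Y_def Z_def G_def)
  then show ?thesis
    using k_positive_Lambda_map_rank_one[OF assms(1), of Y Z] by simp
qed

lemma sum_lessThan_supported_01:
  fixes f :: "nat \<Rightarrow> 'a::comm_monoid_add"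
  assumes "2 \<le> d" "\<And>a. 2 \<le> a \<Longrightarrow> f a = 0"
  shows "(\<Sum>a<d. f a) = f 0 + f 1"
proof -
  have "(\<Sum>a<d. f a) = (\<Sum>a\<in>{0, 1}. f a)"
    using assms by (intro sum.mono_neutral_right) auto
  then show ?thesis by simp
qed

lemma k_positive_Lambda_map_diag:
  assumes "k_positive k d (Lambda_map d \<mu> \<nu>)" "1 \<le> k" "2 \<le> d"
  shows "0 \<le> 1 - \<mu> + \<mu> / d"
  \<comment> \<open>\<open>G = E_00\<close> has \<open>S = P = Q = 1\<close>.\<close>
  using k_positive_Lambda_map_product[OF assms(1,2), of "\<lambda>a. if a = 0 then 1 else 0" "\<lambda>a. if a = 0 then 1 else 0"]
  by (simp add: sum_lessThan_supported_01[OF assms(3)])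

lemma positive_Lambda_map_necessary:
  assumes "k_positive 1 d (Lambda_map d \<mu> \<nu>)" "2 \<le> d"
  shows "0 \<le> \<mu> / d" "0 \<le> 2 * (\<mu> / d) + \<nu>" "0 \<le> 1 - \<mu> - \<nu> + \<mu> / d + \<nu> / d"
proof -
  define m where "m = \<mu> / d"
  note product = k_positive_Lambda_map_product[OF assms(1) order_refl, folded m_def]
  \<comment> \<open>\<open>G = E_01\<close> has \<open>P = 1\<close> and
    \<open>S = Q = 0\<close>.\<close>
  show "0 \<le> \<mu> / d"
    unfolding m_def[symmetric]
    using product[of "\<lambda>a. if a = 0 then 1 else 0" "\<lambda>a. if a = 1 then 1 else 0"]
    by (simp add: sum_lessThan_supported_01[OF assms(2)])
  \<comment> \<open>\<open>G = (e_0 + e_1)(e_0 - e_1)^T\<close> squares to zero, so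
    \<open>S = 0\<close>, while \<open>P = 4\<close> and \<open>Q = 2\<close>.\<close>
  show "0 \<le> 2 * (\<mu> / d) + \<nu>"
    unfolding m_def[symmetric]
    using product[of "\<lambda>a. if a < 2 then 1 else 0" "\<lambda>a. if a = 0 then 1 else if a = 1 then -1 else 0"]
    by (simp add: sum_lessThan_supported_01[OF assms(2)])
  \<comment> \<open>The all-ones matrix has \<open>S = P = d^2\<close> and \<open>Q = d\<close>, the
    equality case of both \<open>P \<ge> S\<close> and \<open>S \<le> d * Q\<close>.\<close>
  have "0 \<le> (1 - \<mu> - \<nu>) * (real d * real d) + m * (real d * real d) + \<nu> * real d"
    using product[of "\<lambda>_. 1" "\<lambda>_. 1"] by simp
  also have "\<dots> = (1 - \<mu> - \<nu> + \<mu> / d + \<nu> / d) * (real d * real d)"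
    using assms(2) by (simp add: m_def field_simps)
  finally show "0 \<le> 1 - \<mu> - \<nu> + \<mu> / d + \<nu> / d"
    using assms(2) by (simp add: zero_le_mult_iff mult_le_0_iff)
qed

lemma k_positive_Lambda_map_necessary:
  assumes "k_positive k d (Lambda_map d \<mu> \<nu>)" "2 \<le> k" "2 \<le> d"
  shows "\<bar>1 - \<mu> - \<nu>\<bar> \<le> \<mu> / d"
proof -
  define \<alpha> m where "\<alpha> = 1 - \<mu> - \<nu>" and "m = \<mu> / d"
  \<comment> \<open>\<open>G = E_01 + s E_10\<close> has \<open>S = 2 * s\<close>,
    \<open>P = 1 + s^2\<close> and \<open>Q = 0\<close>. For \<open>s = 1\<close> and
    \<open>s = -1\<close> its rank is two, which takes two blocks.\<close>
  have "0 \<le> \<alpha> * (2 * s) + m * (1 + s\<^sup>2)" for s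
    using k_positive_Lambda_map_rank_two[OF assms(1,2), of "\<lambda>a. if a = 0 then 1 else 0"
        "\<lambda>a. if a = 1 then 1 else 0" "\<lambda>a. if a = 1 then 1 else 0" "\<lambda>a. if a = 0 then s else 0",
        folded \<alpha>_def m_def]
    by (simp add: sum_lessThan_supported_01[OF assms(3)] algebra_simps)
  from this[of 1] this[of "-1"] show ?thesis
    unfolding \<alpha>_def[symmetric] m_def[symmetric] by (simp add: abs_le_iff)
qed

section \<open>Comparison with the stated parameter regions\<close>

theorem proposition3p1:
  fixes d :: nat and \<mu> \<nu> :: real
  assumes "2 \<le> d"
  shows "(positive_map d (Lambda_map d \<mu> \<nu>) \<longleftrightarrow>
           (0 \<le> \<mu> \<and> \<mu> \<le> real d / (real d - 1)) \<and>
           (- (2 / real d) * \<mu> \<le> \<nu> \<and> \<nu> \<le> real d / (real d - 1) - \<mu>)) \<and>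
         (\<forall>k\<in>{2..d}. k_positive k d (Lambda_map d \<mu> \<nu>) \<longleftrightarrow>
           (0 \<le> \<mu> \<and> \<mu> \<le> real d / (real d - 1)) \<and>
           (1 - (real d + 1) / real d * \<mu> \<le> \<nu> \<and> \<nu> \<le> 1 - (real d - 1) / real d * \<mu>))"
proof -
  have d: "real d > 1" "d > 0" using assms by auto
  \<comment> \<open>The left sides are the conditions met in the decompositions and tests above;
    clearing \<open>d\<close> and \<open>d - 1\<close>, both positive, gives the stated
    bounds.\<close>
  have bounds: "0 \<le> \<mu> / d \<longleftrightarrow> 0 \<le> \<mu>"
    "0 \<le> 1 - \<mu> + \<mu> / d \<longleftrightarrow> \<mu> \<le> real d / (real d - 1)"
    "0 \<le> 2 * (\<mu> / d) + \<nu> \<longleftrightarrow> - (2 / real d) * \<mu> \<le> \<nu>"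
    "0 \<le> 1 - \<mu> - \<nu> + \<mu> / d + \<nu> / d \<longleftrightarrow> \<nu> \<le> real d / (real d - 1) - \<mu>"
    "\<bar>1 - \<mu> - \<nu>\<bar> \<le> \<mu> / d \<longleftrightarrow>
      1 - (real d + 1) / real d * \<mu> \<le> \<nu> \<and> \<nu> \<le> 1 - (real d - 1) / real d * \<mu>"
    using d by (auto simp: field_simps abs_le_iff)
  have positive: "k_positive 1 d (Lambda_map d \<mu> \<nu>) \<longleftrightarrow>
      (0 \<le> \<mu> / d \<and> 0 \<le> 1 - \<mu> + \<mu> / d) \<and>
      (0 \<le> 2 * (\<mu> / d) + \<nu> \<and> 0 \<le> 1 - \<mu> - \<nu> + \<mu> / d + \<nu> / d)"
    using positive_Lambda_map[OF d(2)] positive_Lambda_map_necessary[OF _ assms]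
      k_positive_Lambda_map_diag[OF _ order_refl assms] bounds(1) by blast
  \<comment> \<open>The criterion is the same for all \<open>k \<ge> 2\<close>: sufficiency is
    uniform in \<open>k\<close>, and the tests use a \<open>G\<close> of rank at most two.\<close>
  have k_positive: "k_positive k d (Lambda_map d \<mu> \<nu>) \<longleftrightarrow>
      (0 \<le> \<mu> / d \<and> 0 \<le> 1 - \<mu> + \<mu> / d) \<and> \<bar>1 - \<mu> - \<nu>\<bar> \<le> \<mu> / d" if "2 \<le> k" for k
  proof
    assume pos: "k_positive k d (Lambda_map d \<mu> \<nu>)"
    have "\<bar>1 - \<mu> - \<nu>\<bar> \<le> \<mu> / d"
      using k_positive_Lambda_map_necessary[OF pos that assms] .
    moreover have "0 \<le> 1 - \<mu> + \<mu> / d"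
      using k_positive_Lambda_map_diag[OF pos _ assms] that by simp
    ultimately show "(0 \<le> \<mu> / d \<and> 0 \<le> 1 - \<mu> + \<mu> / d) \<and> \<bar>1 - \<mu> - \<nu>\<bar> \<le> \<mu> / d"
      by (auto intro: order_trans[OF abs_ge_zero])
  qed (use k_positive_Lambda_map in blast)
  show ?thesis
    using positive k_positive
    unfolding bounds k_positive_1_iff_positive_map[OF linear_on_mat_Lambda_map] by simp
qed

end
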